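(* Let $m \geq 1$ be an integer, let $j\in\{1,\dots,m\}$, and let $\Gamma$ be a subgroup of $S_m$ with property $\mathcal{T}_j$. Then two $m$-edge-coloured graphs $G_1$ and $G_2$ are $\Gamma$-switch equivalent if and only if $\mathit{underlying}(G_1) \cong \mathit{underlying}(G_2)$.
   Context: Graphs are finite, undirected and simple (no loops, no multiple edges). An $m$-edge-coloured graph is a pair $G=(H,\Sigma)$ where $H$ is a graph and $\Sigma: E(H)\to\{1,\dots,m\}$ is any function; $\Sigma(e)$ is the colour of $e$. We write $\mathit{underlying}(G)=H$ and $\Sigma(G)=\Sigma$. An isomorphism of $m$-edge-coloured graphs is an isomorphism of the underlying graphs that preserves edge colours. $S_m$ is the symmetric group on $\{1,\dots,m\}$. Let $\Gamma$ be a subgroup of $S_m$. For a vertex $x$ of $G$ and $\pi\in\Gamma$, switching at $x$ with respect to $\pi$ transforms $G$ into the $m$-edge-coloured graph $G^{(x,\pi)}$ with the same underlying graph, in which each edge $xy$ incident with $x$ has colour $\pi(\Sigma(G)(xy))$ and all other edges keep their colours. A $\Gamma$-switching sequence is a finite sequence $\mathcal{S}=(x_1,\pi_1),\dots,(x_t,\pi_t)$ of elements of $V(G)\times\Gamma$, and $G^{\mathcal{S}}$ is the result of performing these switches successively in order. $G_1$ and $G_2$ are $\Gamma$-switch equivalent if there is a $\Gamma$-switching sequence $\mathcal{S}$ with $G_1^{\mathcal{S}}\cong G_2$ (isomorphism of $m$-edge-coloured graphs). For $i,j\in\{1,\dots,m\}$, $\Gamma$ has property $\mathcal{T}_{i,j}$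 if there exist $\alpha,\beta\in\Gamma$ and $k\in\{1,\dots,m\}$ such that $\alpha(i)=j$, $\alpha(k)=k$ and $\beta(j)=k$. $\Gamma$ has property $\mathcal{T}_j$ if it has property $\mathcal{T}_{i,j}$ for all $i\in\{1,\dots,m\}$. *)

theory Defs
  imports "HOL-Algebra.Sym_Groups"
begin

record 'a sgraph =
  verts :: "'a set"
  edges :: "'a set set"

definition simple_graph :: "'a sgraph \<Rightarrow> bool" where
  "simple_graph H \<longleftrightarrow> finite (verts H) \<and> (\<forall>e\<in>edges H. e \<subseteq> verts H \<and> card e = 2)"

definition graph_iso :: "'a sgraph \<Rightarrow> 'b sgraph \<Rightarrow> ('a \<Rightarrow> 'b) \<Rightarrow> bool" where
  "graph_iso H K f \<longleftrightarrow> bij_betw f (verts H) (verts K) \<and>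
     (\<forall>x\<in>verts H. \<forall>y\<in>verts H. {x, y} \<in> edges H \<longleftrightarrow> {f x, f y} \<in> edges K)"

definition graph_isomorphic :: "'a sgraph \<Rightarrow> 'b sgraph \<Rightarrow> bool" where
  "graph_isomorphic H K \<longleftrightarrow> (\<exists>f. graph_iso H K f)"

(* The colouring is a total function on vertex sets; its values outside the edge set are
   irrelevant, and no notion below depends on them. *)
record 'a ec_graph =
  underlying :: "'a sgraph"
  colouring :: "'a set \<Rightarrow> nat"

definition edge_coloured_graph :: "nat \<Rightarrow> 'a ec_graph \<Rightarrow> bool" where
  "edge_coloured_graph m G \<longleftrightarrow>
     simple_graph (underlying G) \<and> colouring G \<in> edges (underlying G) \<rightarrow> {1..m}"

definition ec_isomorphic :: "'a ec_graph \<Rightarrow> 'b ec_graph \<Rightarrow> bool" where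
  "ec_isomorphic G G' \<longleftrightarrow> (\<exists>f. graph_iso (underlying G) (underlying G') f \<and>
     (\<forall>e\<in>edges (underlying G). colouring G' (f ` e) = colouring G e))"

definition switch :: "'a \<Rightarrow> (nat \<Rightarrow> nat) \<Rightarrow> 'a ec_graph \<Rightarrow> 'a ec_graph" where
  "switch x \<pi> G = G\<lparr>colouring := \<lambda>e. if e \<in> edges (underlying G) \<and> x \<in> e
                                     then \<pi> (colouring G e) else colouring G e\<rparr>"

definition switch_seq :: "('a \<times> (nat \<Rightarrow> nat)) list \<Rightarrow> 'a ec_graph \<Rightarrow> 'a ec_graph" where
  "switch_seq S G = fold (\<lambda>(x, \<pi>). switch x \<pi>) S G"

definition switch_equivalent :: "(nat \<Rightarrow> nat) set \<Rightarrow> 'a ec_graph \<Rightarrow> 'b ec_graph \<Rightarrow> bool" where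
  "switch_equivalent \<Gamma> G1 G2 \<longleftrightarrow>
     (\<exists>S. set S \<subseteq> verts (underlying G1) \<times> \<Gamma> \<and> ec_isomorphic (switch_seq S G1) G2)"

definition property_T_pair :: "nat \<Rightarrow> (nat \<Rightarrow> nat) set \<Rightarrow> nat \<Rightarrow> nat \<Rightarrow> bool" where
  "property_T_pair m \<Gamma> i j \<longleftrightarrow>
     (\<exists>\<alpha>\<in>\<Gamma>. \<exists>\<beta>\<in>\<Gamma>. \<exists>k\<in>{1..m}. \<alpha> i = j \<and> \<alpha> k = k \<and> \<beta> j = k)"

definition property_T :: "nat \<Rightarrow> (nat \<Rightarrow> nat) set \<Rightarrow> nat \<Rightarrow> bool" where
  "property_T m \<Gamma> j \<longleftrightarrow> (\<forall>i\<in>{1..m}. property_T_pair m \<Gamma> i j)"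

end

theory Submission
  imports Defs
begin

text \<open>
  Switching never changes the underlying graph, so switch equivalent graphs have isomorphic
  underlying graphs. For the converse, the point is that a single edge can be recoloured at will
  while all other edges keep their colours. Switching at the two ends \<open>x\<close>, \<open>y\<close> of an edge
  with respect to \<open>\<alpha>\<close>, \<open>\<beta>\<close>, \<open>\<alpha>\<inverse>\<close>, \<open>\<beta>\<inverse>\<close>, at \<open>x\<close> and \<open>y\<close> alternately, cancels on every edge that
  meets only one of the two ends, and acts on \<open>xy\<close> as the commutator \<open>\<beta>\<inverse>\<alpha>\<inverse>\<beta>\<alpha>\<close>
  (lemma \<open>switch_seq_commutator\<close>).

  If \<open>\<alpha>\<close>, \<open>\<beta>\<close>, \<open>k\<close> witness the property for the pair \<open>i\<close>, \<open>j\<close>, then this commutator moves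
  \<open>i\<close> along \<open>i \<mapsto> j \<mapsto> k \<mapsto> k \<mapsto> j\<close>. Its inverse is again a commutator, with the roles of
  \<open>\<alpha>\<close> and \<open>\<beta>\<close> exchanged, and takes \<open>j\<close> to \<open>i\<close>. Hence an edge of any colour can be given
  colour \<open>j\<close> and from there any colour at all (lemma \<open>switch_seq_recolour_edge\<close>). Treating the edges
  one after another, every colouring of the underlying graph of \<open>G1\<close> is reached
  (lemma \<open>switch_seq_reaches_every_colouring\<close>), in particular the one pulled back from \<open>G2\<close> along
  an isomorphism of the underlying graphs.
\<close>

lemma underlying_switch [simp]: "underlying (switch x \<pi> G) = underlying G"
  by (simp add: switch_def)

lemma colouring_switch:
  "colouring (switch x \<pi> G) e =
    (if e \<in> edges (underlying G) \<and> x \<in> e then \<pi> (colouring G e) else colouring G e)"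
  by (simp add: switch_def)

lemma underlying_switch_seq [simp]: "underlying (switch_seq S G) = underlying G"
  by (induction S arbitrary: G) (auto simp: switch_seq_def)

lemma switch_seq_append: "switch_seq (S @ T) G = switch_seq T (switch_seq S G)"
  by (simp add: switch_seq_def)

lemma graph_iso_image_edge:
  assumes "graph_iso H K f" and "simple_graph H" and "e \<in> edges H"
  shows "f ` e \<in> edges K"
proof -
  have "e \<subseteq> verts H" "card e = 2"
    using assms(2,3) by (auto simp: simple_graph_def)
  moreover from this obtain x y where "e = {x, y}"
    by (auto simp: card_2_iff)
  ultimately show ?thesis
    using assms(1,3) by (auto simp: graph_iso_def)
qed

lemma simple_graph_finite_edges: "simple_graph H \<Longrightarrow> finite (edges H)"
  by (rule finite_subset[of _ "Pow (verts H)"]) (auto simp: simple_graph_def)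

text \<open>
  An edge meeting only \<open>x\<close> sees \<open>\<alpha>\<close> followed by its inverse, and likewise for \<open>y\<close> and
  \<open>\<beta>\<close>; since the edges have two ends, only \<open>{x, y}\<close> sees all four permutations.
\<close>
lemma switch_seq_commutator:
  assumes "simple_graph (underlying G)" and "{x, y} \<in> edges (underlying G)"
    and "inj \<alpha>" and "inj \<beta>"
  shows "colouring (switch_seq [(x, \<alpha>), (y, \<beta>), (x, inv' \<alpha>), (y, inv' \<beta>)] G) =
    (colouring G)({x, y} := inv' \<beta> (inv' \<alpha> (\<beta> (\<alpha> (colouring G {x, y})))))"
proof -
  have "e = {x, y}" if "e \<in> edges (underlying G)" "x \<in> e" "y \<in> e" for e
  proof -
    have "card e = 2" "card {x, y} = 2"
      using assms(1,2) that(1) by (auto simp: simple_graph_def)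
    moreover from this have "finite e"
      by (simp add: card_ge_0_finite)
    ultimately show ?thesis
      using that(2,3) card_subset_eq[of e "{x, y}"] by simp
  qed
  then have ends: "e \<in> edges (underlying G) \<Longrightarrow> x \<in> e \<Longrightarrow> y \<in> e \<longleftrightarrow> e = {x, y}" for e
    by auto
  show ?thesis
  proof
    fix e
    consider "e = {x, y}" | "e \<noteq> {x, y}" "\<not> (e \<in> edges (underlying G) \<and> x \<in> e)"
        "\<not> (e \<in> edges (underlying G) \<and> y \<in> e)"
      | "e \<noteq> {x, y}" "e \<in> edges (underlying G)" "x \<in> e" "y \<notin> e"
      | "e \<noteq> {x, y}" "e \<in> edges (underlying G)" "x \<notin> e" "y \<in> e"
      using ends by blast
    then show "colouring (switch_seq [(x, \<alpha>), (y, \<beta>), (x, inv' \<alpha>), (y, inv' \<beta>)] G) e =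
      ((colouring G)({x, y} := inv' \<beta> (inv' \<alpha> (\<beta> (\<alpha> (colouring G {x, y})))))) e"
      using assms(2-4) by cases (simp_all only: switch_seq_def colouring_switch underlying_switch fold.simps
        comp_apply prod.case id_apply fun_upd_apply if_True if_False simp_thms insert_iff inv_f_f)
  qed
qed

lemma subgroup_sym_group_permutes:
  assumes "subgroup \<Gamma> (sym_group m)" and "\<pi> \<in> \<Gamma>"
  shows "\<pi> permutes {1..m}" and "inv' \<pi> \<in> \<Gamma>"
proof -
  have carrier: "\<pi> \<in> carrier (sym_group m)"
    by (rule subgroup.mem_carrier[OF assms])
  then show "\<pi> permutes {1..m}"
    by (simp add: sym_group_carrier)
  show "inv' \<pi> \<in> \<Gamma>"
    using subgroup.m_inv_closed[OF assms] unfolding sym_group_inv_equality[OF carrier] .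
qed

text \<open>
  Since \<open>\<alpha>\<close> fixes \<open>k\<close>, the factor that stands between \<open>\<beta>\<close> and its inverse has no effect
  on the chosen colour. The first commutator moves
  \<open>i \<mapsto> j \<mapsto> k \<mapsto> k \<mapsto> j\<close>, its inverse \<open>j \<mapsto> k \<mapsto> k \<mapsto> j \<mapsto> i\<close>.
\<close>
lemma commutator_moves:
  assumes "\<alpha> permutes A" and "\<beta> permutes A" and "\<alpha> i = j" and "\<alpha> k = k" and "\<beta> j = k"
  shows "inv' \<beta> (inv' \<alpha> (\<beta> (\<alpha> i))) = j" and "inv' \<alpha> (inv' \<beta> (\<alpha> (\<beta> j))) = i"
proof -
  have inverses: "inv' \<alpha> k = k" "inv' \<alpha> j = i" "inv' \<beta> k = j"
    using assms by (simp_all add: permutes_inv_eq)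
  show "inv' \<beta> (inv' \<alpha> (\<beta> (\<alpha> i))) = j"
    by (simp only: assms(3-5) inverses)
  show "inv' \<alpha> (inv' \<beta> (\<alpha> (\<beta> j))) = i"
    by (simp only: assms(3-5) inverses)
qed

text \<open>
  The edge passes from its old colour to \<open>q\<close> through \<open>j\<close>: the property only provides
  commutators that take a given colour to \<open>j\<close>, and their inverses.
\<close>
lemma switch_seq_recolour_edge:
  assumes graph: "simple_graph (underlying G)" and edge: "e \<in> edges (underlying G)"
    and sub: "subgroup \<Gamma> (sym_group m)" and T: "property_T m \<Gamma> j"
    and c: "colouring G e \<in> {1..m}" and q: "q \<in> {1..m}"
  shows "\<exists>S. set S \<subseteq> verts (underlying G) \<times> \<Gamma> \<and>
    colouring (switch_seq S G) = (colouring G)(e := q)"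
proof -
  note perm = subgroup_sym_group_permutes[OF sub]
  obtain x y where e: "e = {x, y}" and xy: "x \<in> verts (underlying G)" "y \<in> verts (underlying G)"
    using graph edge by (auto simp: simple_graph_def card_2_iff)
  have commutator: "colouring (switch_seq [(x, \<alpha>), (y, \<beta>), (x, inv' \<alpha>), (y, inv' \<beta>)] G') =
      (colouring G')(e := inv' \<beta> (inv' \<alpha> (\<beta> (\<alpha> (colouring G' e)))))"
    if "underlying G' = underlying G" "\<alpha> \<in> \<Gamma>" "\<beta> \<in> \<Gamma>" for G' \<alpha> \<beta>
    using switch_seq_commutator[of G' x y \<alpha> \<beta>] graph edge that
      permutes_inj[OF perm(1)[OF that(2)]] permutes_inj[OF perm(1)[OF that(3)]]
    unfolding e by simp
  from T c obtain \<alpha> \<beta> k where in_\<Gamma>: "\<alpha> \<in> \<Gamma>" "\<beta> \<in> \<Gamma>"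
    and to_j: "\<alpha> (colouring G e) = j" "\<alpha> k = k" "\<beta> j = k"
    unfolding property_T_def property_T_pair_def by blast
  from T q obtain \<alpha>' \<beta>' k' where in_\<Gamma>': "\<alpha>' \<in> \<Gamma>" "\<beta>' \<in> \<Gamma>"
    and from_q: "\<alpha>' q = j" "\<alpha>' k' = k'" "\<beta>' j = k'"
    unfolding property_T_def property_T_pair_def by blast
  let ?S = "[(x, \<alpha>), (y, \<beta>), (x, inv' \<alpha>), (y, inv' \<beta>)]"
  let ?S' = "[(x, \<beta>'), (y, \<alpha>'), (x, inv' \<beta>'), (y, inv' \<alpha>')]"
  have "inv' \<beta> (inv' \<alpha> (\<beta> (\<alpha> (colouring G e)))) = j"
    by (rule commutator_moves(1)[OF in_\<Gamma>[THEN perm(1)] to_j])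
  then have S: "colouring (switch_seq ?S G) = (colouring G)(e := j)"
    using commutator[of G] in_\<Gamma> by simp
  have "inv' \<alpha>' (inv' \<beta>' (\<alpha>' (\<beta>' j))) = q"
    by (rule commutator_moves(2)[OF in_\<Gamma>'[THEN perm(1)] from_q])
  then have "colouring (switch_seq (?S @ ?S') G) = (colouring G)(e := q)"
    unfolding switch_seq_append using commutator[of "switch_seq ?S G" \<beta>' \<alpha>'] S in_\<Gamma>' by simp
  moreover have "set (?S @ ?S') \<subseteq> verts (underlying G) \<times> \<Gamma>"
    using xy in_\<Gamma> in_\<Gamma>' perm(2) by simp
  ultimately show ?thesis
    by blast
qed

lemma switch_seq_reaches_every_colouring:
  assumes G: "edge_coloured_graph m G"
    and sub: "subgroup \<Gamma> (sym_group m)" and T: "property_T m \<Gamma> j"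
    and C: "C \<in> edges (underlying G) \<rightarrow> {1..m}"
  shows "\<exists>S. set S \<subseteq> verts (underlying G) \<times> \<Gamma> \<and>
    (\<forall>e\<in>edges (underlying G). colouring (switch_seq S G) e = C e)"
proof -
  have graph: "simple_graph (underlying G)"
    and col: "colouring G \<in> edges (underlying G) \<rightarrow> {1..m}"
    using G by (auto simp: edge_coloured_graph_def)
  have "\<exists>S. set S \<subseteq> verts (underlying G) \<times> \<Gamma> \<and>
      colouring (switch_seq S G) = (\<lambda>e. if e \<in> A then C e else colouring G e)"
    if "finite A" "A \<subseteq> edges (underlying G)" for A
    using that
  proof (induction A rule: finite_induct)
    case empty
    show ?case
      by (rule exI[of _ "[]"]) (simp add: switch_seq_def)
  next
    case (insert e A)
    then obtain S where S: "set S \<subseteq> verts (underlying G) \<times> \<Gamma>"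
      and cS: "colouring (switch_seq S G) = (\<lambda>e. if e \<in> A then C e else colouring G e)"
      by auto
    have "colouring (switch_seq S G) e \<in> {1..m}" "C e \<in> {1..m}"
      using insert.prems C col by (auto simp: cS Pi_iff)
    then obtain S' where S': "set S' \<subseteq> verts (underlying G) \<times> \<Gamma>"
      and cS': "colouring (switch_seq S' (switch_seq S G)) =
        (colouring (switch_seq S G))(e := C e)"
      using switch_seq_recolour_edge[of "switch_seq S G" e \<Gamma> m j "C e"] graph insert.prems sub T
      by auto
    show ?case
      using S S' cS' by (intro exI[of _ "S @ S'"]) (auto simp: switch_seq_append cS)
  qed
  from this[OF simple_graph_finite_edges[OF graph] order_refl] show ?thesis
    by auto
qed

theorem corollary2p5:
  fixes m j :: nat and \<Gamma> :: "(nat \<Rightarrow> nat) set"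
    and G1 :: "'a ec_graph" and G2 :: "'b ec_graph"
  assumes "m \<ge> 1" and "j \<in> {1..m}"
    and "subgroup \<Gamma> (sym_group m)" and "property_T m \<Gamma> j"
    and "edge_coloured_graph m G1" and "edge_coloured_graph m G2"
  shows "switch_equivalent \<Gamma> G1 G2 \<longleftrightarrow>
         graph_isomorphic (underlying G1) (underlying G2)"
proof
  assume "switch_equivalent \<Gamma> G1 G2"
  then show "graph_isomorphic (underlying G1) (underlying G2)"
    by (auto simp: switch_equivalent_def ec_isomorphic_def graph_isomorphic_def)
next
  assume "graph_isomorphic (underlying G1) (underlying G2)"
  then obtain f where f: "graph_iso (underlying G1) (underlying G2) f"
    by (auto simp: graph_isomorphic_def)
  have "(\<lambda>e. colouring G2 (f ` e)) \<in> edges (underlying G1) \<rightarrow> {1..m}"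
    using graph_iso_image_edge[OF f] assms(5,6) by (auto simp: edge_coloured_graph_def Pi_iff)
  from switch_seq_reaches_every_colouring[OF assms(5,3,4) this] obtain S
    where "set S \<subseteq> verts (underlying G1) \<times> \<Gamma>"
      and "\<forall>e\<in>edges (underlying G1). colouring (switch_seq S G1) e = colouring G2 (f ` e)"
    by blast
  then show "switch_equivalent \<Gamma> G1 G2"
    unfolding switch_equivalent_def ec_isomorphic_def
    using f by (metis underlying_switch_seq)
qed

end
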